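(* For every $n\geq 1$, the polynomial $q\,C_{n,123}(p,q,r)$ is symmetric in $p$ and $q$ (i.e. it is unchanged by interchanging $p$ and $q$). Furthermore, $$\sum_{\sigma\in\mathcal{Q}_n(123)}p^{\mathrm{plat}(\sigma)}=\frac{1}{n+1}\sum_{j=0}^{n}\binom{n+1}{j}\binom{2n-j}{n+j}p^{n-j}.$$
   Context: A Stirling permutation of order $n$ is a permutation $\sigma=\sigma_1\cdots\sigma_{2n}$ of the multiset $\{1,1,2,2,\ldots,n,n\}$ such that, for each $i\in[n]$, every entry between the two occurrences of $i$ is greater than $i$; $\mathcal{Q}_n$ denotes the set of these. For $\sigma\in\mathcal{Q}_n$: $\mathrm{des}(\sigma)=\#\{i: 1\le i\le 2n-1,\ \sigma_i>\sigma_{i+1}\}$, $\mathrm{asc}(\sigma)=\#\{i: 1\le i\le 2n-1,\ \sigma_i<\sigma_{i+1}\}$, $\mathrm{plat}(\sigma)=\#\{i: 1\le i\le 2n-1,\ \sigma_i=\sigma_{i+1}\}$. $\sigma$ contains the pattern $123$ if there are indices $i_1<i_2<i_3$ with $\sigma_{i_1}<\sigma_{i_2}<\sigma_{i_3}$; otherwise it avoids $123$. $\mathcal{Q}_n(123)$ is the set of $\sigma\in\mathcal{Q}_n$ avoiding $123$, and $C_{n,123}(p,q,r)=\sum_{\sigma\in\mathcal{Q}_n(123)}p^{\mathrm{plat}(\sigma)}q^{\mathrm{des}(\sigma)}r^{\mathrm{asc}(\sigma)}$. *)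

theory Defs
  imports Complex_Main "HOL-Library.Multiset"
begin

text \<open>
  Words are lists, so positions are 0-based: \<open>\<sigma> ! i\<close> is the letter
  at position \<open>i + 1\<close> in the usual notation.  As every letter occurs exactly twice, the two
  occurrences of a letter are the positions \<open>i < k\<close> with \<open>\<sigma> ! i = \<sigma> ! k\<close>.
\<close>

definition stirling_perms :: "nat \<Rightarrow> nat list set" where
  "stirling_perms n = {\<sigma>. mset \<sigma> = mset_set {1..n} + mset_set {1..n} \<and>
     (\<forall>i j k. i < j \<and> j < k \<and> k < length \<sigma> \<and> \<sigma> ! i = \<sigma> ! k \<longrightarrow> \<sigma> ! j > \<sigma> ! i)}"

definition des :: "nat list \<Rightarrow> nat" where
  "des \<sigma> = card {i. Suc i < length \<sigma> \<and> \<sigma> ! i > \<sigma> ! Suc i}"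

definition asc :: "nat list \<Rightarrow> nat" where
  "asc \<sigma> = card {i. Suc i < length \<sigma> \<and> \<sigma> ! i < \<sigma> ! Suc i}"

definition plat :: "nat list \<Rightarrow> nat" where
  "plat \<sigma> = card {i. Suc i < length \<sigma> \<and> \<sigma> ! i = \<sigma> ! Suc i}"

definition contains_123 :: "nat list \<Rightarrow> bool" where
  "contains_123 \<sigma> \<longleftrightarrow>
     (\<exists>i j k. i < j \<and> j < k \<and> k < length \<sigma> \<and> \<sigma> ! i < \<sigma> ! j \<and> \<sigma> ! j < \<sigma> ! k)"

definition stirling_perms_avoiding_123 :: "nat \<Rightarrow> nat list set" where
  "stirling_perms_avoiding_123 n = {\<sigma> \<in> stirling_perms n. \<not> contains_123 \<sigma>}"

text \<open>
  The generating polynomial, evaluated at arbitrary elements of a commutative ring.  An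
  identity that holds for all commutative rings is an identity of formal polynomials: take
  the indeterminates of a (nested) polynomial ring over the integers as arguments.
\<close>

definition C_123 :: "nat \<Rightarrow> 'a::comm_ring_1 \<Rightarrow> 'a \<Rightarrow> 'a \<Rightarrow> 'a" where
  "C_123 n p q r =
     (\<Sum>\<sigma>\<in>stirling_perms_avoiding_123 n. p ^ plat \<sigma> * q ^ des \<sigma> * r ^ asc \<sigma>)"

lemma finite_stirling_perms: "finite (stirling_perms n)"
proof (rule finite_subset)
  show "stirling_perms n \<subseteq> {\<sigma>. set \<sigma> \<subseteq> {1..n} \<and> length \<sigma> = 2 * n}"
  proof
    fix \<sigma> assume "\<sigma> \<in> stirling_perms n"
    then have eq: "mset \<sigma> = mset_set {1..n} + mset_set {1..n}"
      by (simp add: stirling_perms_def)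
    from arg_cong[OF eq, of set_mset] arg_cong[OF eq, of size]
    show "\<sigma> \<in> {\<sigma>. set \<sigma> \<subseteq> {1..n} \<and> length \<sigma> = 2 * n}"
      by simp
  qed
  show "finite {\<sigma>. set \<sigma> \<subseteq> {1..n} \<and> length \<sigma> = 2 * n}"
    by (rule finite_lists_length_eq) simp
qed

lemma finite_stirling_perms_avoiding_123: "finite (stirling_perms_avoiding_123 n)"
  by (simp add: stirling_perms_avoiding_123_def finite_stirling_perms)

end

theory Submission
  imports Defs "HOL-Computational_Algebra.Formal_Power_Series"
begin

text \<open>
  Let \<open>m\<^sub>k > \<dots> > m\<^sub>1\<close> be the left-to-right minima of a 123-avoiding Stirling permutation, so that it
  reads \<open>m\<^sub>k B\<^sub>k m\<^sub>k C\<^sub>k \<dots> m\<^sub>1 B\<^sub>1 m\<^sub>1 C\<^sub>1\<close>.  The word \<open>B\<^sub>k C\<^sub>k \<dots> B\<^sub>1 C\<^sub>1\<close> of the other letters is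
  weakly decreasing with both copies of a letter adjacent, hence the permutation is determined by the
  minima and the lengths of all blocks, and these are constrained only through the sums
  \<open>|B\<^sub>i| + |C\<^sub>i|\<close>.  If the last letter counts as a descent, then plateaus correspond to the
  non-minima and the empty \<open>B\<^sub>i\<close>, descents to the non-minima and the empty \<open>C\<^sub>i\<close>; exchanging the lengths
  of \<open>B\<^sub>i\<close> and \<open>C\<^sub>i\<close> gives the symmetry.

  Removing the letters from the smallest to the largest turns the generating function into that of
  weighted Lukasiewicz words with \<open>n + 1\<close> steps, a minimum with \<open>a\<close> distinct letters in its two
  blocks being a step of degree \<open>a + 1\<close> and a non-minimum a step of degree \<open>0\<close>.  Their number is
  \<open>1 / (n + 1)\<close> times the coefficient of \<open>t\<^sup>n\<close> in \<open>W\<^bsup>n + 1\<^esup>\<close>, where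
  \<open>W = 1 / (1 - x t) + x t\<^sup>2 / (1 - x t)\<^sup>2\<close> is the generating function of the weights of the degrees.
\<close>

section \<open>Words avoiding patterns of length three\<close>

text \<open>A ternary \<open>sorted_wrt\<close>: conditions on triples of positions can then be
  checked blockwise in a concatenation.\<close>

fun triples_wrt :: "('a \<Rightarrow> 'a \<Rightarrow> 'a \<Rightarrow> bool) \<Rightarrow> 'a list \<Rightarrow> bool" where
  "triples_wrt P [] \<longleftrightarrow> True"
| "triples_wrt P (x # xs) \<longleftrightarrow> sorted_wrt (P x) xs \<and> triples_wrt P xs"

lemma triples_wrt_append:
  "triples_wrt P (xs @ ys) \<longleftrightarrow> triples_wrt P xs \<and> triples_wrt P ys \<and>
     (\<forall>x\<in>set xs. sorted_wrt (P x) ys) \<and> (\<forall>y\<in>set ys. sorted_wrt (\<lambda>a b. P a b y) xs)"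
  by (induction xs) (auto simp: sorted_wrt_append)

lemma triples_wrt_iff_nth:
  "triples_wrt P xs \<longleftrightarrow>
     (\<forall>i j k. i < j \<and> j < k \<and> k < length xs \<longrightarrow> P (xs ! i) (xs ! j) (xs ! k))"
proof (induction xs)
  case (Cons x xs)
  show ?case (is "_ \<longleftrightarrow> ?R")
  proof
    assume *: "triples_wrt P (x # xs)"
    show ?R
    proof (intro allI impI)
      fix i j k assume "i < j \<and> j < k \<and> k < length (x # xs)"
      then show "P ((x # xs) ! i) ((x # xs) ! j) ((x # xs) ! k)"
        using * Cons.IH
        by (cases i; cases j; cases k) (auto simp: sorted_wrt_iff_nth_less)
    qed
  next
    assume R: ?R
    have "P x (xs ! j) (xs ! k)" if "j < k" "k < length xs" for j k
      using R[rule_format, of 0 "Suc j" "Suc k"] that by simp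
    moreover have "P (xs ! i) (xs ! j) (xs ! k)" if "i < j" "j < k" "k < length xs" for i j k
      using R[rule_format, of "Suc i" "Suc j" "Suc k"] that by simp
    ultimately show "triples_wrt P (x # xs)"
      using Cons.IH by (auto simp: sorted_wrt_iff_nth_less)
  qed
qed simp

text \<open>Merges both requirements on letters at three increasing positions: no pattern 123, and
  only larger letters between equal ones.\<close>

definition admissible :: "nat \<Rightarrow> nat \<Rightarrow> nat \<Rightarrow> bool" where
  "admissible x y z \<longleftrightarrow> \<not> (x < y \<and> y < z) \<and> (x = z \<longrightarrow> x < y)"

section \<open>Decreasing words with doubled letters\<close>

fun dup :: "'a list \<Rightarrow> 'a list" where
  "dup [] = []"
| "dup (x # xs) = x # x # dup xs"

lemma set_dup [simp]: "set (dup xs) = set xs"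
  by (induction xs) auto

lemma length_dup [simp]: "length (dup xs) = 2 * length xs"
  by (induction xs) auto

lemma mset_dup: "mset (dup xs) = mset xs + mset xs"
  by (induction xs) auto

lemma sorted_wrt_ge_dup: "sorted_wrt (>) (xs :: nat list) \<Longrightarrow> sorted_wrt (\<ge>) (dup xs)"
  by (induction xs) (auto intro: less_imp_le)

lemma triples_wrt_admissible_dup:
  "sorted_wrt (>) xs \<Longrightarrow> triples_wrt admissible (dup xs)"
proof (induction xs)
  case (Cons x xs)
  have "sorted_wrt (admissible x) (dup xs)"
    by (rule sorted_wrt_mono_rel[OF _ sorted_wrt_ge_dup])
      (use Cons.prems in \<open>auto simp: admissible_def\<close>)
  moreover have "admissible x x y" if "y \<in> set xs" for y
    using that Cons.prems by (auto simp: admissible_def)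
  ultimately show ?case using Cons by simp
qed simp

definition desc_list :: "nat set \<Rightarrow> nat list" where
  "desc_list S = rev (sorted_list_of_set S)"

lemma
  assumes "finite S"
  shows set_desc_list [simp]: "set (desc_list S) = S"
    and length_desc_list [simp]: "length (desc_list S) = card S"
    and distinct_desc_list: "distinct (desc_list S)"
    and sorted_desc_list: "sorted_wrt (>) (desc_list S)"
  using assms by (auto simp: desc_list_def sorted_wrt_rev)

lemma sorted_gt_unique:
  assumes "sorted_wrt (>) (xs :: nat list)" "sorted_wrt (>) ys" "set xs = set ys"
  shows "xs = ys"
proof -
  have "rev xs = rev ys"
    using assms by (intro strict_sorted_equal) (auto simp: sorted_wrt_rev)
  then show ?thesis by simp
qed

lemma desc_list_Un:
  assumes "finite X" "finite Y" "\<And>x y. x \<in> X \<Longrightarrow> y \<in> Y \<Longrightarrow> y < x"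
  shows "desc_list (X \<union> Y) = desc_list X @ desc_list Y"
  using assms by (intro sorted_gt_unique) (auto simp: sorted_wrt_append sorted_desc_list)

text \<open>A weakly decreasing word is determined by its multiset of letters.\<close>

lemma desc_dup_eq:
  assumes "sorted_wrt (\<ge>) (xs :: nat list)" "\<And>y. y \<in> set xs \<Longrightarrow> count (mset xs) y = 2"
  shows "xs = dup (desc_list (set xs))"
proof -
  have "mset xs = mset (dup (desc_list (set xs)))"
  proof (rule multiset_eqI)
    fix y
    have "count (mset (desc_list (set xs))) y = (if y \<in> set xs then 1 else 0)"
      using distinct_count_atmost_1[of "desc_list (set xs)"] distinct_desc_list[of "set xs"] by simp
    then show "count (mset xs) y = count (mset (dup (desc_list (set xs)))) y"
      using assms(2)[of y] by (auto simp: mset_dup)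
  qed
  then have "rev xs = rev (dup (desc_list (set xs)))"
    using assms sorted_wrt_ge_dup[OF sorted_desc_list[of "set xs"]]
    by (metis List.finite_set mset_rev properties_for_sort sorted_wrt_rev)
  then show ?thesis by simp
qed

section \<open>Partial words and removal of the smallest letter\<close>

text \<open>
  The \<open>s\<close> letters of \<open>S\<close> that are missing from a partial word are those which become non-minima in
  the blocks of minima that have already been removed; appending them twice each in decreasing order
  must not create the pattern 123.
\<close>

definition partial_words :: "nat set \<Rightarrow> nat \<Rightarrow> nat list set" where
  "partial_words S s = {\<alpha>. set \<alpha> \<subseteq> S \<and> card (S - set \<alpha>) = s \<and>
     (\<forall>y\<in>set \<alpha>. count (mset \<alpha>) y = 2) \<and> triples_wrt admissible \<alpha> \<and>
     (\<forall>y\<in>S - set \<alpha>. sorted_wrt (\<lambda>a b. \<not> (a < b \<and> b < y)) \<alpha>)}"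

lemma finite_partial_words:
  assumes "finite S"
  shows "finite (partial_words S s)"
proof (rule finite_subset)
  show "partial_words S s \<subseteq> {\<alpha>. set \<alpha> \<subseteq> S \<and> length \<alpha> \<le> 2 * card S}"
  proof
    fix \<alpha> assume *: "\<alpha> \<in> partial_words S s"
    have "length \<alpha> = (\<Sum>y\<in>set \<alpha>. count (mset \<alpha>) y)"
      by (metis set_mset_mset size_mset size_multiset_overloaded_eq)
    also have "\<dots> = 2 * card (set \<alpha>)"
      using * by (simp add: partial_words_def)
    also have "\<dots> \<le> 2 * card S"
      using * assms by (auto simp: partial_words_def card_mono)
    finally show "\<alpha> \<in> {\<alpha>. set \<alpha> \<subseteq> S \<and> length \<alpha> \<le> 2 * card S}"
      using * by (auto simp: partial_words_def)
  qed
qed (use assms finite_lists_length_le in auto)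

lemma partial_words_empty_if_less:
  assumes "finite S" "card S < s"
  shows "partial_words S s = {}"
proof -
  have "card (S - set \<alpha>) \<le> card S" for \<alpha>
    using assms by (auto intro: card_mono)
  with assms show ?thesis
    unfolding partial_words_def using leD by blast
qed

lemma partial_words_empty: "partial_words {} s = (if s = 0 then {[]} else {})"
  by (auto simp: partial_words_def)

text \<open>A missing \<open>v\<close> is one of the \<open>s\<close> missing letters, and it cannot
  complete a 123 because all letters of the word exceed it.\<close>

lemma partial_words_without_min:
  assumes "finite S" "\<And>x. x \<in> S \<Longrightarrow> v < x"
  shows "{\<alpha> \<in> partial_words (insert v S) s. v \<notin> set \<alpha>} =
           (if s = 0 then {} else partial_words S (s - 1))"
proof -
  have v: "v \<notin> S" using assms(2) by blast
  have card: "card (insert v S - set \<alpha>) = Suc (card (S - set \<alpha>))" if "v \<notin> set \<alpha>" for \<alpha>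
    using that v assms(1) by (simp add: insert_Diff_if)
  moreover have "v \<notin> set \<alpha>" if "set \<alpha> \<subseteq> S" for \<alpha>
    using that v by blast
  moreover have "sorted_wrt (\<lambda>a b. \<not> (a < b \<and> b < v)) \<alpha>" if "set \<alpha> \<subseteq> S" for \<alpha>
    unfolding sorted_wrt_iff_nth_less
    using that assms(2) by (meson less_asym nth_mem subsetD)
  ultimately show ?thesis
    using v by (auto simp: partial_words_def)
qed

text \<open>
  The two blocks after the new minimum \<open>v\<close> consist of the \<open>a\<close> largest missing letters, of which the
  first \<open>b\<close> go between the two copies of \<open>v\<close>.
\<close>

definition append_min :: "nat \<Rightarrow> nat set \<Rightarrow> nat \<Rightarrow> nat \<Rightarrow> nat list \<Rightarrow> nat list" where
  "append_min v S a b A =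
     A @ v # dup (take b (desc_list (S - set A))) @
         v # dup (take (a - b) (drop b (desc_list (S - set A))))"

text \<open>The letters missing from \<open>A\<close> complete no 123 with two letters of
  \<open>A\<close>; the new letters after \<open>v\<close> decrease; both copies of each lie in one
  block, so no \<open>v\<close> separates them.\<close>

lemma append_min_in_partial_words:
  assumes fin: "finite S" and v: "\<And>x. x \<in> S \<Longrightarrow> v < x"
    and A: "A \<in> partial_words S (s + a)" and b: "b \<le> a"
  shows "append_min v S a b A \<in> partial_words (insert v S) s"
proof -
  define L where "L = desc_list (S - set A)"
  define e1 e2 d where "e1 = take b L" and "e2 = take (a - b) (drop b L)" and "d = drop a L"
  have L: "L = e1 @ e2 @ d"
    unfolding e1_def e2_def d_def using b
    by (metis append_take_drop_id drop_drop le_add_diff_inverse2)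
  have sL: "sorted_wrt (>) L" and setL: "set L = S - set A" and dL: "distinct L"
    using fin by (simp_all add: L_def sorted_desc_list distinct_desc_list)
  have lenL: "length L = s + a"
    using A fin by (simp add: L_def partial_words_def)
  have srt: "sorted_wrt (>) e1" "sorted_wrt (>) e2"
    "\<And>x y. x \<in> set e1 \<Longrightarrow> y \<in> set e2 \<Longrightarrow> y < x"
    "\<And>x y. x \<in> set e1 \<union> set e2 \<Longrightarrow> y \<in> set d \<Longrightarrow> y < x"
    using sL by (auto simp: L sorted_wrt_append)
  have vnot: "v \<notin> S" using v by blast
  have setA: "set A \<subseteq> S" using A by (simp add: partial_words_def)
  have sub: "set e1 \<subseteq> S - set A" "set e2 \<subseteq> S - set A" "set d \<subseteq> S - set A"
    and all: "S - set A = set e1 \<union> set e2 \<union> set d"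
    using setL L by auto
  have disj: "set e1 \<inter> set e2 = {}" "set e1 \<inter> set d = {}" "set e2 \<inter> set d = {}"
    "distinct e1" "distinct e2" "distinct d"
    using dL L by auto
  let ?w = "A @ v # dup e1 @ v # dup e2"
  have tA: "triples_wrt admissible A" and cA: "\<And>y. y \<in> set A \<Longrightarrow> count (mset A) y = 2"
    and pA: "\<And>y. y \<in> S - set A \<Longrightarrow> sorted_wrt (\<lambda>a b. \<not> (a < b \<and> b < y)) A"
    using A by (auto simp: partial_words_def)
  have setw: "insert v S - set ?w = set d"
    using all disj vnot setA sub by auto
  have "card (set d) = s"
    using lenL disj by (simp add: distinct_card d_def)
  moreover have "count (mset ?w) y = 2" if "y \<in> set ?w" for y
  proof -
    have *: "count (mset e1) z = (if z \<in> set e1 then 1 else 0)"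
      "count (mset e2) z = (if z \<in> set e2 then 1 else 0)" for z
      using disj distinct_count_atmost_1 by metis+
    show ?thesis
      using that cA[of y] vnot setA sub disj
      by (auto simp: mset_dup *)
  qed
  moreover have "sorted_wrt (\<lambda>a b. \<not> (a < b \<and> b < y)) ?w" if y: "y \<in> set d" for y
  proof -
    have yS: "y \<in> S - set A" using y sub by blast
    have 1: "sorted_wrt (\<lambda>a b. \<not> (a < b \<and> b < y)) (dup e)" if "sorted_wrt (>) e" for e
      by (rule sorted_wrt_mono_rel[OF _ sorted_wrt_ge_dup[OF that]]) auto
    have 2: "\<not> (x < v \<and> v < y)" if "x \<in> insert v S" for x
      using v[of x] that by auto
    \<comment> \<open>A letter that is still missing lies below every inserted one, so no inserted
      letter can be the middle of a 123 that it completes.\<close>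
    have 3: "\<not> (x < z \<and> z < y)" if "z \<in> set e1 \<union> set e2" for x z
      using srt(4)[OF that y] by simp
    have 4: "set A \<subseteq> S" "set e1 \<subseteq> S" "set e2 \<subseteq> S" using setA sub by auto
    show ?thesis
      unfolding sorted_wrt_append sorted_wrt.simps set_append list.set set_dup
      using pA[OF yS] 1[OF srt(1)] 1[OF srt(2)] 2 3 4
      by (intro conjI ballI) blast+
  qed
  moreover have "triples_wrt admissible ?w"
  proof -
    have sA: "sorted_wrt (\<lambda>a b. admissible a b y) A" if "y \<in> insert v (S - set A)" for y
    proof (cases "y = v")
      case True
      have "sorted_wrt (\<lambda>_ _. True) A" by (simp add: sorted_wrt_iff_nth_less)
      then show ?thesis
        by (rule sorted_wrt_mono_rel[rotated]) (use True v setA in \<open>fastforce simp: admissible_def dest: less_asym\<close>)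
    next
      case False
      then have "y \<in> S - set A" using that by blast
      from pA[OF this] show ?thesis
        by (rule sorted_wrt_mono_rel[rotated]) (use False that in \<open>auto simp: admissible_def\<close>)
    qed
    have 2: "sorted_wrt (admissible x) (dup e)" if "sorted_wrt (>) e" "x \<notin> set e" for e x
      by (rule sorted_wrt_mono_rel[OF _ sorted_wrt_ge_dup[OF that(1)]])
        (use that(2) in \<open>auto simp: admissible_def\<close>)
    have 3: "sorted_wrt (\<lambda>a b. admissible a b y) (dup e)" if "sorted_wrt (>) e" "y \<notin> set e" for e y
      by (rule sorted_wrt_mono_rel[OF _ sorted_wrt_ge_dup[OF that(1)]])
        (use that(2) in \<open>auto simp: admissible_def\<close>)
    have lt: "v < x" if "x \<in> set A \<or> x \<in> set e1 \<or> x \<in> set e2" for x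
      using that setA sub v by auto
    have adm1: "admissible v v y" "admissible v y v" "y \<noteq> v"
      if "y \<in> set e1 \<or> y \<in> set e2" for y
      using lt[of y] that by (auto simp: admissible_def)
    have adm2: "admissible v y z" "admissible y v z" "admissible y z v"
      if "y \<in> set e1" "z \<in> set e2" for y z
      using lt[of y] lt[of z] srt(3)[OF that] that by (auto simp: admissible_def)
    have adm3: "admissible x v z" "admissible x z v"
      if "x \<in> set A" "z \<in> set e1 \<or> z \<in> set e2" for x z
      using lt[of x] lt[of z] sub that by (auto simp: admissible_def)
    have adm4: "admissible x y z" if "x \<in> set A" "y \<in> set e1" "z \<in> set e2" for x y z
      using srt(3)[OF that(2,3)] that sub by (auto simp: admissible_def)
    have adm5: "admissible x v v" if "x \<in> set A" for x
      using lt[of x] that by (auto simp: admissible_def)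
    have ne: "z \<notin> set e2" if "z \<in> set e1" for z
      using that disj(1) by blast
    have ne': "z \<notin> set e1" if "z \<in> set e2" for z
      using that disj(1) by blast
    have neA: "x \<notin> set e1" "x \<notin> set e2" if "x \<in> set A" for x
      using that sub by auto
    have nev: "v \<notin> set e1" "v \<notin> set e2"
      using sub vnot by auto
    have "triples_wrt admissible (v # dup e1 @ v # dup e2)"
      using srt(1,2)
      by (simp add: triples_wrt_append sorted_wrt_append triples_wrt_admissible_dup
          2 3 adm1 adm2 ne ne' nev)
    moreover have "sorted_wrt (admissible x) (v # dup e1 @ v # dup e2)" if "x \<in> set A" for x
      using that srt(1,2)
      by (auto simp: sorted_wrt_append 2 adm3 adm4 adm5 neA)
    moreover have "sorted_wrt (\<lambda>a b. admissible a b y) A" if "y \<in> set (v # dup e1 @ v # dup e2)" for y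
      using that sub by (intro sA) auto
    ultimately show ?thesis
      using tA by (simp only: triples_wrt_append) blast
  qed
  moreover have "set ?w \<subseteq> insert v S"
    using setA sub by auto
  ultimately have "?w \<in> partial_words (insert v S) s"
    unfolding partial_words_def setw mem_Collect_eq by blast
  then show ?thesis
    by (simp add: append_min_def e1_def e2_def L_def)
qed

text \<open>Cut at the two copies of \<open>v\<close>. Triples starting with \<open>v\<close> force
  the other letters after it to decrease, triples with \<open>v\<close> in the middle keep equal
  letters in one part, and the condition on missing letters makes the blocks use the largest letters
  available.\<close>

lemma partial_words_with_minE:
  assumes fin: "finite S" and v: "\<And>x. x \<in> S \<Longrightarrow> v < x"
    and \<alpha>: "\<alpha> \<in> partial_words (insert v S) s" "v \<in> set \<alpha>"
  obtains a b A where "b \<le> a" "A \<in> partial_words S (s + a)" "\<alpha> = append_min v S a b A"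
proof -
  from \<alpha>(2) obtain A R where AR: "\<alpha> = A @ v # R" "v \<notin> set A"
    by (meson split_list_first)
  have cnt: "count (mset \<alpha>) y = 2" if "y \<in> set \<alpha>" for y
    using \<alpha>(1) that by (simp add: partial_words_def)
  have "count (mset A) v = 0"
    using AR(2) by simp
  with cnt[OF \<alpha>(2)] have "count (mset R) v = 1"
    by (simp add: AR(1))
  moreover from this have "v \<in> set R"
    by (metis count_mset_0_iff zero_neq_one)
  then obtain B C where BC: "R = B @ v # C" "v \<notin> set B"
    by (meson split_list_first)
  ultimately have "count (mset C) v = 0"
    by simp
  then have vC: "v \<notin> set C"
    by simp
  note \<alpha>_eq = AR(1)[unfolded BC(1)]
  have tr: "triples_wrt admissible (A @ v # B @ v # C)"
    using \<alpha>(1) \<alpha>_eq by (simp add: partial_words_def)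
  have sub: "set A \<subseteq> S" "set B \<subseteq> S" "set C \<subseteq> S"
    using \<alpha>(1) AR(2) BC vC \<alpha>_eq by (auto simp: partial_words_def)
  have vnot: "v \<notin> S" using v by blast
  have "sorted_wrt (admissible v) (B @ C)"
    using tr by (auto simp: triples_wrt_append sorted_wrt_append)
  moreover have "y \<le> x" if "x \<in> set (B @ C)" "admissible v x y" for x y
    using that sub v[of x] by (auto simp: admissible_def)
  ultimately have srt: "sorted_wrt (\<ge>) (B @ C)"
    by (metis (mono_tags, lifting) sorted_wrt_mono_rel)
  have trA: "sorted_wrt (admissible x) (v # B @ v # C)" if "x \<in> set A" for x
    using tr that by (simp only: triples_wrt_append)
  have "triples_wrt admissible (v # B @ v # C)"
    using tr by (simp only: triples_wrt_append)
  then have trB: "sorted_wrt (admissible x) (v # C)" if "x \<in> set B" for x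
    using that by (simp only: triples_wrt_append triples_wrt.simps)
  have "admissible x v y" if "x \<in> set A" "y \<in> set B \<union> set C" for x y
    using trA[OF that(1)] that(2) by auto
  moreover have "admissible x v y" if "x \<in> set B" "y \<in> set C" for x y
    using trB[OF that(1)] that(2) by auto
  \<comment> \<open>Equal letters cannot surround the smaller \<open>v\<close>, so \<open>A\<close>,
    \<open>B\<close> and \<open>C\<close> share no letter.\<close>
  moreover have "\<not> admissible x v x" if "x \<in> S" for x
    using v[OF that] by (simp add: admissible_def)
  ultimately have disj: "set A \<inter> set B = {}" "set A \<inter> set C = {}" "set B \<inter> set C = {}"
    using sub by blast+
  have zero: "count (mset A) y = 0 \<and> count (mset C) y = 0 \<and> y \<noteq> v" if "y \<in> set B" for y
    using that disj sub vnot by auto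
  have cB: "count (mset B) y = 2" if "y \<in> set B" for y
    using cnt[of y] zero[OF that] that by (simp add: \<alpha>_eq)
  have zero: "count (mset A) y = 0 \<and> count (mset B) y = 0 \<and> y \<noteq> v" if "y \<in> set C" for y
    using that disj sub vnot by auto
  have cC: "count (mset C) y = 2" if "y \<in> set C" for y
    using cnt[of y] zero[OF that] that by (simp add: \<alpha>_eq)
  have zero: "count (mset B) y = 0 \<and> count (mset C) y = 0 \<and> y \<noteq> v" if "y \<in> set A" for y
    using that disj sub vnot by auto
  have cA: "count (mset A) y = 2" if "y \<in> set A" for y
    using cnt[of y] zero[OF that] that by (simp add: \<alpha>_eq)
  have B: "B = dup (desc_list (set B))" and C: "C = dup (desc_list (set C))"
    using srt cB cC by (auto intro!: desc_dup_eq simp: sorted_wrt_append)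
  define D where "D = insert v S - set \<alpha>"
  have D: "D \<subseteq> S" "S - set A = set B \<union> (set C \<union> D)" "D \<inter> set A = {}" "D \<inter> set B = {}" "D \<inter> set C = {}"
    using sub disj vnot by (auto simp: D_def \<alpha>_eq)
  have finD: "finite D" using D fin finite_subset by blast
  have pD: "sorted_wrt (\<lambda>a b. \<not> (a < b \<and> b < y)) (A @ v # B @ v # C)" if "y \<in> D" for y
    using \<alpha>(1) that \<alpha>_eq by (simp add: partial_words_def D_def)
  \<comment> \<open>Otherwise \<open>v\<close>, \<open>x\<close> and the missing letter
    \<open>y\<close> would form a 123.\<close>
  have "y \<le> x" if "y \<in> D" "x \<in> set B \<union> set C" for x y
  proof -
    have "v < x" using that(2) sub v by blast
    moreover have "\<forall>x\<in>set B \<union> set C. v < x \<longrightarrow> \<not> x < y"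
      using pD[OF that(1)] by (simp add: sorted_wrt_append)
    ultimately show ?thesis using that(2) by (meson not_less)
  qed
  then have DBC: "y < x" if "y \<in> D" "x \<in> set B \<union> set C" for x y
    using that D by (metis Un_iff disjoint_iff order_le_less)
  have CB: "y < x" if "x \<in> set B" "y \<in> set C" for x y
  proof -
    have "y \<le> x" using srt that by (simp add: sorted_wrt_append)
    moreover have "y \<noteq> x" using that disj by blast
    ultimately show ?thesis by simp
  qed
  \<comment> \<open>The blocks and the leftover \<open>D\<close> are consecutive segments of this
    list, so \<open>take\<close> and \<open>drop\<close> recover \<open>B\<close> and
    \<open>C\<close>.\<close>
  have dl: "desc_list (S - set A) = desc_list (set B) @ desc_list (set C) @ desc_list D"
  proof -
    have "desc_list (set B \<union> (set C \<union> D)) = desc_list (set B) @ desc_list (set C \<union> D)"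
      by (rule desc_list_Un) (use DBC CB finD in auto)
    also have "desc_list (set C \<union> D) = desc_list (set C) @ desc_list D"
      by (rule desc_list_Un) (use DBC finD in auto)
    finally show ?thesis by (simp add: D(2))
  qed
  have cardD: "card D = s"
    using \<alpha>(1) by (simp add: partial_words_def D_def)
  define a b where "a = card (set B) + card (set C)" and "b = card (set B)"
  have "card (S - set A) = s + a"
    using arg_cong[OF dl, of length] fin finD cardD by (simp add: a_def)
  moreover have "sorted_wrt (\<lambda>a b. \<not> (a < b \<and> b < y)) A" if "y \<in> S - set A" for y
  proof (cases "y \<in> D")
    case True
    from pD[OF this] show ?thesis by (simp add: sorted_wrt_append)
  next
    case False
    then have "y \<in> set B \<union> set C" using that D by blast
    then have "sorted_wrt (\<lambda>a b. admissible a b y) A"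
      using tr by (auto simp: triples_wrt_append)
    then show ?thesis
      by (rule sorted_wrt_mono_rel[rotated]) (auto simp: admissible_def)
  qed
  ultimately have "A \<in> partial_words S (s + a)"
    using sub cA tr by (simp add: partial_words_def triples_wrt_append)
  moreover have "\<alpha> = append_min v S a b A"
    using B C by (simp add: append_min_def \<alpha>_eq dl a_def b_def)
  ultimately show ?thesis
    using that[of b a A] by (simp add: a_def b_def)
qed

lemma append_Cons_cancel:
  assumes "v \<notin> set xs" "v \<notin> set xs'"
  shows "xs @ v # ys = xs' @ v # ys' \<longleftrightarrow> xs = xs' \<and> ys = ys'"
  using assms
proof (induction xs arbitrary: xs')
  case Nil
  then show ?case by (cases xs') auto
next
  case (Cons x xs)
  then show ?case by (cases xs') auto
qed

text \<open>The copies of \<open>v\<close> delimit \<open>A\<close> and the two blocks, whose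
  lengths give \<open>b\<close> and \<open>a\<close>.\<close>

lemma inj_on_append_min:
  assumes fin: "finite S" and v: "\<And>x. x \<in> S \<Longrightarrow> v < x"
  shows "inj_on (\<lambda>(a, b, A). append_min v S a b A)
           (SIGMA a:{..N}. {..a} \<times> partial_words S (s + a))"
proof (rule inj_onI, clarsimp)
  fix a b A a' b' A'
  assume *: "b \<le> a" "A \<in> partial_words S (s + a)" "b' \<le> a'" "A' \<in> partial_words S (s + a')"
    and eq: "append_min v S a b A = append_min v S a' b' A'"
  have vnot: "v \<notin> S" using v by blast
  have vA: "v \<notin> set A" "v \<notin> set A'"
    using * vnot by (auto simp: partial_words_def)
  have vt: "v \<notin> set (take i (desc_list (S - X)))" "v \<notin> set (take i (drop j (desc_list (S - X))))" for i j X
    using vnot fin in_set_takeD[of v i] in_set_dropD[of v j "desc_list (S - X)"] by fastforce+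
  have A: "A = A'"
    using eq vA unfolding append_min_def by (simp add: append_Cons_cancel)
  have "dup (take b (desc_list (S - set A))) = dup (take b' (desc_list (S - set A)))"
    "dup (take (a - b) (drop b (desc_list (S - set A)))) =
     dup (take (a' - b') (drop b' (desc_list (S - set A))))"
    using eq vt unfolding append_min_def A by (simp_all add: append_Cons_cancel)
  from this[THEN arg_cong[of _ _ length]]
  show "a = a' \<and> b = b' \<and> A = A'"
    using * A fin by (auto simp: partial_words_def)
qed

section \<open>Weights\<close>

text \<open>The last letter contributes a factor \<open>q\<close>, as if it were followed by a descent.\<close>

fun weight :: "'a::comm_ring_1 \<Rightarrow> 'a \<Rightarrow> 'a \<Rightarrow> nat list \<Rightarrow> 'a" where
  "weight p q r [] = 1"
| "weight p q r [x] = q"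
| "weight p q r (x # y # xs) =
     (if x = y then p else if y < x then q else r) * weight p q r (y # xs)"

lemma card_adjacent_Cons:
  "card {i. Suc i < length (x # y # xs) \<and> P ((x # y # xs) ! i) ((x # y # xs) ! Suc i)} =
     (if P x y then 1 else 0) + card {i. Suc i < length (y # xs) \<and> P ((y # xs) ! i) ((y # xs) ! Suc i)}"
  (is "card ?L = _ + card ?R")
proof -
  have "i \<in> ?L \<longleftrightarrow> i \<in> (if P x y then {0} else {}) \<union> Suc ` ?R" for i
    by (cases i) auto
  then have "?L = (if P x y then {0} else {}) \<union> Suc ` ?R"
    by blast
  moreover have "finite ?R"
    by (rule finite_subset[of _ "{..length (y # xs)}"]) auto
  ultimately show ?thesis
    by (simp add: card_image)
qed

lemma
  shows plat_Cons_Cons: "plat (x # y # xs) = (if x = y then 1 else 0) + plat (y # xs)"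
    and des_Cons_Cons: "des (x # y # xs) = (if x > y then 1 else 0) + des (y # xs)"
    and asc_Cons_Cons: "asc (x # y # xs) = (if x < y then 1 else 0) + asc (y # xs)"
  unfolding plat_def des_def asc_def by (rule card_adjacent_Cons)+

text \<open>The extra \<open>q\<close> is the conventional descent after the last letter; it turns
  the generating polynomial into \<open>q * C_123 n p q r\<close>.\<close>

lemma weight_eq:
  "\<sigma> \<noteq> [] \<Longrightarrow> weight p q r \<sigma> = q * (p ^ plat \<sigma> * q ^ des \<sigma> * r ^ asc \<sigma>)"
proof (induction p q r \<sigma> rule: weight.induct)
  case (2 p q r x)
  then show ?case by (simp add: plat_def des_def asc_def)
next
  case (3 p q r x y xs)
  then show ?case
    by (auto simp: plat_Cons_Cons des_Cons_Cons asc_Cons_Cons mult_ac)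
qed simp

text \<open>The step from \<open>A\<close> down to \<open>v\<close> is a descent, which is just the
  factor \<open>q\<close> already charged to the last letter of \<open>A\<close>.\<close>

lemma weight_append_Cons:
  "\<forall>x\<in>set A. v < x \<Longrightarrow> weight p q r (A @ v # R) = weight p q r A * weight p q r (v # R)"
  by (induction p q r A rule: weight.induct) (auto simp: mult.assoc)

lemma weight_dup: "sorted_wrt (>) e \<Longrightarrow> weight p q r (dup e) = (p * q) ^ length e"
proof (induction e)
  case (Cons x e)
  then show ?case by (cases e) (auto simp: mult_ac)
qed simp

text \<open>The first \<open>v\<close> starts a plateau if the block is empty and an ascent
  otherwise; each doubled letter gives a plateau and a descent.\<close>

lemma weight_Cons_dup_append:
  assumes "sorted_wrt (>) e" "\<forall>x\<in>set e. v < x"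
  shows "weight p q r (v # dup e @ v # R) =
           (if e = [] then p else r) * (p * q) ^ length e * weight p q r (v # R)"
proof (cases e)
  case (Cons y e')
  have "weight p q r (v # dup e @ v # R) = r * weight p q r (dup e @ v # R)"
    using assms Cons by auto
  also have "weight p q r (dup e @ v # R) = weight p q r (dup e) * weight p q r (v # R)"
    using assms by (intro weight_append_Cons) simp
  finally have eq: "weight p q r (v # dup e @ v # R) = r * (weight p q r (dup e) * weight p q r (v # R))" .
  show ?thesis
    unfolding eq weight_dup[OF assms(1)] using Cons by (simp add: mult_ac)
qed simp

lemma weight_Cons_dup:
  assumes "sorted_wrt (>) e" "\<forall>x\<in>set e. v < x"
  shows "weight p q r (v # dup e) = (if e = [] then q else r) * (p * q) ^ length e"
proof (cases e)
  case (Cons y e')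
  have "weight p q r (v # dup e) = r * weight p q r (dup e)"
    using assms Cons by auto
  then show ?thesis
    using Cons weight_dup[OF assms(1), of p q r] by simp
qed simp

text \<open>The \<open>a\<close> inserted letters give \<open>p * q\<close> each; the two copies of
  \<open>v\<close> give the remaining factors, according to whether the block after each is
  empty.\<close>

lemma weight_append_min:
  assumes fin: "finite S" and v: "\<And>x. x \<in> S \<Longrightarrow> v < x"
    and A: "A \<in> partial_words S (s + a)" and b: "b \<le> a"
  shows "weight p q r (append_min v S a b A) =
    (p * q) ^ a * (if b = 0 then p else r) * (if b = a then q else r) * weight p q r A"
proof -
  define L where "L = desc_list (S - set A)"
  define e1 e2 where "e1 = take b L" and "e2 = take (a - b) (drop b L)"
  have L: "L = e1 @ e2 @ drop a L"
    unfolding e1_def e2_def using b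
    by (metis append_take_drop_id drop_drop le_add_diff_inverse2)
  have "length L = s + a"
    using A fin by (simp add: L_def partial_words_def)
  then have len: "length e1 = b" "length e2 = a - b"
    using b by (auto simp: e1_def e2_def)
  have "sorted_wrt (>) L"
    using fin by (simp add: L_def sorted_desc_list)
  then have srt: "sorted_wrt (>) e1" "sorted_wrt (>) e2"
    by (metis L sorted_wrt_append)+
  have "set L \<subseteq> S"
    using fin by (simp add: L_def)
  then have gt: "\<forall>x\<in>set e1. v < x" "\<forall>x\<in>set e2. v < x"
    using v L by (metis Un_iff set_append subsetD)+
  have "\<forall>x\<in>set A. v < x"
    using A v by (auto simp: partial_words_def)
  then have "weight p q r (append_min v S a b A) = weight p q r A *
      ((if e1 = [] then p else r) * (p * q) ^ length e1 *
      ((if e2 = [] then q else r) * (p * q) ^ length e2))"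
    unfolding append_min_def L_def[symmetric] e1_def[symmetric] e2_def[symmetric]
    by (simp only: weight_append_Cons weight_Cons_dup_append[OF srt(1) gt(1)]
        weight_Cons_dup[OF srt(2) gt(2)])
  moreover have "e1 = [] \<longleftrightarrow> b = 0" "e2 = [] \<longleftrightarrow> b = a"
    using len b by (auto simp flip: length_0_conv)
  moreover have "(p * q) ^ a = (p * q) ^ b * (p * q) ^ (a - b)"
    using b by (simp flip: power_add)
  ultimately show ?thesis
    by (simp add: len mult_ac)
qed

section \<open>The recurrence\<close>

text \<open>Weighted paths of \<open>m\<close> steps from height \<open>s\<close> to 0, the height
  being the number of missing letters: a non-minimum lowers it by one, a minimum with
  \<open>a\<close> letters in its blocks raises it by \<open>a\<close>.\<close>

fun gen :: "'a::comm_ring_1 \<Rightarrow> 'a \<Rightarrow> 'a \<Rightarrow> nat \<Rightarrow> nat \<Rightarrow> 'a" where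
  "gen p q r 0 s = (if s = 0 then 1 else 0)"
| "gen p q r (Suc m) s = (if s = 0 then 0 else gen p q r m (s - 1)) +
     (\<Sum>a\<le>m. (\<Sum>b\<le>a. (p * q) ^ a * (if b = 0 then p else r) * (if b = a then q else r)) *
        gen p q r m (s + a))"

text \<open>Split by whether the least letter \<open>v\<close> occurs: if not, it is dropped from
  the alphabet; if so, \<open>append_min\<close> is a bijection from the triples
  \<open>(a, b, A)\<close>.\<close>

lemma sum_weight_partial_words:
  assumes "finite S"
  shows "(\<Sum>\<alpha>\<in>partial_words S s. weight p q r \<alpha>) = gen p q r (card S) s"
  using assms
proof (induction S arbitrary: s rule: finite_linorder_min_induct)
  case empty
  then show ?case by (simp add: partial_words_empty)
next
  case (insert v S)
  let ?X = "partial_words (insert v S) s"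
  let ?I = "SIGMA a:{..card S}. {..a} \<times> partial_words S (s + a)"
  let ?f = "\<lambda>(a, b, A). append_min v S a b A"
  let ?c = "\<lambda>a b. (p * q) ^ a * (if b = 0 then p else r) * (if b = a then q else r)"
  have v: "\<And>x. x \<in> S \<Longrightarrow> v < x" and fin: "finite S"
    using insert.hyps by auto
  have "{\<alpha> \<in> ?X. v \<in> set \<alpha>} = ?f ` ?I"
  proof (intro equalityI subsetI)
    fix \<alpha> assume "\<alpha> \<in> {\<alpha> \<in> ?X. v \<in> set \<alpha>}"
    then obtain a b A where *: "b \<le> a" "A \<in> partial_words S (s + a)" "\<alpha> = append_min v S a b A"
      using partial_words_with_minE[OF fin v, of \<alpha> s] by blast
    \<comment> \<open>No more letters can be missing than the alphabet has, so the range of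
      \<open>a\<close> is finite.\<close>
    then have "s + a \<le> card S"
      using partial_words_empty_if_less[OF fin, of "s + a"] by fastforce
    with * show "\<alpha> \<in> ?f ` ?I"
      by (intro image_eqI[of _ _ "(a, b, A)"]) auto
  next
    fix \<alpha> assume "\<alpha> \<in> ?f ` ?I"
    then show "\<alpha> \<in> {\<alpha> \<in> ?X. v \<in> set \<alpha>}"
      using append_min_in_partial_words[OF fin v] by (auto simp: append_min_def)
  qed
  then have "(\<Sum>\<alpha>\<in>{\<alpha> \<in> ?X. v \<in> set \<alpha>}. weight p q r \<alpha>) = (\<Sum>i\<in>?I. weight p q r (?f i))"
    using inj_on_append_min[OF fin v] by (simp only: sum.reindex o_def)
  also have "\<dots> = (\<Sum>(a, b, A)\<in>?I. ?c a b * weight p q r A)"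
    by (intro sum.cong) (auto simp: weight_append_min[OF fin v])
  also have "\<dots> = (\<Sum>a\<le>card S. \<Sum>(b, A)\<in>{..a} \<times> partial_words S (s + a). ?c a b * weight p q r A)"
    using fin by (subst sum.Sigma) (auto simp: finite_partial_words)
  also have "\<dots> = (\<Sum>a\<le>card S. (\<Sum>b\<le>a. ?c a b) * gen p q r (card S) (s + a))"
    by (simp add: sum.cartesian_product[symmetric] sum_product insert.IH[symmetric])
  finally have with_min: "(\<Sum>\<alpha>\<in>{\<alpha> \<in> ?X. v \<in> set \<alpha>}. weight p q r \<alpha>) = \<dots>" .
  have without_min: "(\<Sum>\<alpha>\<in>{\<alpha> \<in> ?X. v \<notin> set \<alpha>}. weight p q r \<alpha>) =
      (if s = 0 then 0 else gen p q r (card S) (s - 1))"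
    using partial_words_without_min[OF fin v, of s] insert.IH by simp
  have "(\<Sum>\<alpha>\<in>?X. weight p q r \<alpha>) =
      (\<Sum>\<alpha>\<in>{\<alpha> \<in> ?X. v \<notin> set \<alpha>}. weight p q r \<alpha>) + (\<Sum>\<alpha>\<in>{\<alpha> \<in> ?X. v \<in> set \<alpha>}. weight p q r \<alpha>)"
    by (subst sum.union_disjoint[symmetric])
      (use fin in \<open>auto simp: finite_partial_words intro!: sum.cong\<close>)
  moreover have "card (insert v S) = Suc (card S)"
    using fin v by (subst card_insert_disjoint) auto
  ultimately show ?case
    by (simp add: with_min without_min)
qed

text \<open>Replacing \<open>b\<close> by \<open>a - b\<close> exchanges the lengths of the two
  blocks of a minimum.\<close>

lemma gen_swap: "gen p q r m s = gen q p r m s"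
proof (induction m arbitrary: s)
  case (Suc m)
  have "(\<Sum>b\<le>a. (p * q) ^ a * (if b = 0 then p else r) * (if b = a then q else r)) =
        (\<Sum>b\<le>a. (q * p) ^ a * (if b = 0 then q else r) * (if b = a then p else r))" for a
    by (rule sum.reindex_bij_witness[of _ "\<lambda>b. a - b" "\<lambda>b. a - b"]) (auto simp: mult_ac)
  with Suc show ?case by simp
qed simp

section \<open>The closed form\<close>

unbundle fps_syntax

text \<open>The series W: the constant term belongs to a non-minimum, and the coefficient at
  \<open>l = a + 1\<close> sums the weights of a minimum over all splittings of \<open>a\<close>,
  with \<open>p = x\<close> and \<open>q = r = 1\<close>.\<close>

definition degree_fps :: "'a::comm_ring_1 \<Rightarrow> 'a fps" where
  "degree_fps x = Abs_fps (\<lambda>l. if l = 0 then 1 else x ^ (l - 1) * (x + of_nat (l - 1)))"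

text \<open>A step lowers the height by at most one.\<close>

lemma gen_eq_0: "m < s \<Longrightarrow> gen p q r m s = 0"
  by (induction m arbitrary: s) auto

text \<open>Indexing by the degree \<open>l\<close> merges both kinds of removal into one move to
  height \<open>s + l - 1\<close>, which makes the sum a convolution.\<close>

lemma gen_1_1_Suc:
  assumes "s \<le> Suc m"
  shows "gen x 1 1 (Suc m) s =
    (\<Sum>l=0..Suc m - s. degree_fps x $ l * (if s + l = 0 then 0 else gen x 1 1 m (s + l - 1)))"
proof -
  let ?h = "\<lambda>l. degree_fps x $ l * (if s + l = 0 then 0 else gen x 1 1 m (s + l - 1))"
  \<comment> \<open>With \<open>q = r = 1\<close>, only an empty first block carries a factor
    different from 1.\<close>
  have "(\<Sum>b\<le>a. if b = 0 then x else 1) = x + of_nat a" for a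
    by (induction a) auto
  then have "gen x 1 1 (Suc m) s = ?h 0 + (\<Sum>a\<le>m. ?h (Suc a))"
    by (simp add: degree_fps_def sum_distrib_left[symmetric])
  also have "\<dots> = (\<Sum>l\<le>Suc m. ?h l)"
    by (simp only: sum.atMost_Suc_shift)
  also have "\<dots> = (\<Sum>l=0..Suc m - s. ?h l)"
    by (rule sum.mono_neutral_right) (auto simp: gen_eq_0)
  finally show ?thesis .
qed

text \<open>
  The Lagrange inversion formula: the right-hand side satisfies the recurrence because
  \<open>t W' W\<^bsup>m + 1\<^esup> = t (W\<^bsup>m + 2\<^esup>)' / (m + 2)\<close>.
\<close>

lemma gen_1_1:
  fixes x :: "'a::field_char_0"
  assumes "s \<le> m"
  shows "gen x 1 1 m s = of_nat (s + 1) / of_nat (m + 1) * (degree_fps x ^ (m + 1)) $ (m - s)"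
  using assms
proof (induction m arbitrary: s)
  case 0
  then show ?case by (simp add: degree_fps_def)
next
  case (Suc m)
  define W where "W = degree_fps x"
  define P where "P = W ^ (m + 2)"
  define M where "M = Suc m - s"
  have "gen x 1 1 (Suc m) s =
      (\<Sum>l=0..M. W $ l * (of_nat (s + l) / of_nat (m + 1) * (W ^ (m + 1)) $ (M - l)))"
    unfolding gen_1_1_Suc[OF Suc.prems] M_def[symmetric] W_def[symmetric]
  proof (intro sum.cong refl)
    fix l assume "l \<in> {0..M}"
    then have l: "s + l \<le> Suc m" using Suc.prems by (auto simp: M_def)
    show "W $ l * (if s + l = 0 then 0 else gen x 1 1 m (s + l - 1)) =
          W $ l * (of_nat (s + l) / of_nat (m + 1) * (W ^ (m + 1)) $ (M - l))"
    proof (cases "s + l = 0")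
      case False
      then have "m - (s + l - 1) = M - l" "s + l - 1 + 1 = s + l"
        using l by (auto simp: M_def)
      moreover have "s + l - 1 \<le> m" using l False by simp
      ultimately show ?thesis
        using Suc.IH[of "s + l - 1"] False by (simp only: W_def if_False)
    qed simp
  qed
  also have "\<dots> = (of_nat s * (\<Sum>l=0..M. W $ l * (W ^ (m + 1)) $ (M - l)) +
      (\<Sum>l=0..M. (fps_X * fps_deriv W) $ l * (W ^ (m + 1)) $ (M - l))) / of_nat (m + 1)"
  proof -
    \<comment> \<open>Split \<open>s + l\<close>: differentiation produces the factor
      \<open>l\<close>, and \<open>fps_X\<close> restores the index.\<close>
    have "(fps_X * fps_deriv W) $ l = of_nat l * W $ l" for l
      by (cases l) auto
    then show ?thesis
      by (simp add: sum_distrib_left sum_divide_distrib sum.distrib[symmetric] field_simps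
          del: power_Suc)
  qed
  also have "(\<Sum>l=0..M. W $ l * (W ^ (m + 1)) $ (M - l)) = P $ M"
    by (simp add: fps_mult_nth[symmetric] P_def)
  also have "(\<Sum>l=0..M. (fps_X * fps_deriv W) $ l * (W ^ (m + 1)) $ (M - l)) =
      of_nat M / of_nat (m + 2) * P $ M"
  proof -
    have "fps_X * fps_deriv P = fps_const (of_nat (m + 2)) * (fps_X * fps_deriv W * W ^ (m + 1))"
      unfolding P_def fps_deriv_power by (simp add: mult_ac)
    then have "(fps_X * fps_deriv P) $ M = of_nat (m + 2) * (fps_X * fps_deriv W * W ^ (m + 1)) $ M"
      by (simp only: fps_mult_left_const_nth)
    moreover have "(fps_X * fps_deriv P) $ M = of_nat M * P $ M"
      by (cases M) auto
    moreover have "of_nat (m + 2) \<noteq> (0 :: 'a)"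
      by (simp only: of_nat_eq_0_iff)
    ultimately show ?thesis
      unfolding fps_mult_nth[symmetric] by (simp add: field_simps del: of_nat_add)
  qed
  also have "(of_nat s * P $ M + of_nat M / of_nat (m + 2) * P $ M) / of_nat (m + 1) =
      of_nat (s + 1) / of_nat (m + 2) * P $ M"
  proof -
    have nz: "of_nat (m + 2) \<noteq> (0 :: 'a)" "of_nat (m + 1) \<noteq> (0 :: 'a)"
      by (simp_all only: of_nat_eq_0_iff)
    have "s * (m + 2) + M = (s + 1) * (m + 1)"
      using Suc.prems by (simp add: M_def algebra_simps)
    then have *: "of_nat s * of_nat (m + 2) + of_nat M = (of_nat (s + 1) * of_nat (m + 1) :: 'a)"
      by (metis of_nat_add of_nat_mult)
    have "(of_nat s * P $ M + of_nat M / of_nat (m + 2) * P $ M) / of_nat (m + 1) =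
        (of_nat s * of_nat (m + 2) + of_nat M) * P $ M / (of_nat (m + 2) * of_nat (m + 1))"
      using nz by (simp add: field_simps del: of_nat_add)
    also have "\<dots> = of_nat (s + 1) / of_nat (m + 2) * P $ M"
      unfolding * using nz(2) by (simp del: of_nat_add)
    finally show ?thesis .
  qed
  finally show ?case
    by (simp add: P_def W_def M_def)
qed

section \<open>Explicit coefficients of the powers of W\<close>

text \<open>For positive \<open>l\<close> the coefficient is
  \<open>x ^ l + (l - 1) * x ^ (l - 1)\<close>, a geometric part plus a derivative-like part;
  pulling out \<open>V\<close> prepares the binomial theorem.\<close>

lemma degree_fps_eq:
  fixes x :: "'a::field_char_0"
  defines "V \<equiv> inverse (1 - fps_const x * fps_X)"
  shows "degree_fps x = V * (fps_const x * fps_X ^ 2 * V + 1)"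
proof (rule fps_ext)
  fix l
  have V1: "V $ k = x ^ k" for k
    using one_minus_const_fps_X_neg_power'[of 1 x] by (simp add: V_def)
  have "V ^ 2 = Abs_fps (\<lambda>k. of_nat ((2 + k - 1) choose k) * x ^ k)"
    using one_minus_const_fps_X_neg_power'[of 2 x] by (simp add: V_def fps_inverse_power)
  then have V2: "V ^ 2 $ k = of_nat (k + 1) * x ^ k" for k
    by (simp add: binomial_symmetric[of k "Suc k"])
  have "V * (fps_const x * fps_X ^ 2 * V + 1) = V + fps_const x * (fps_X ^ 2 * V ^ 2)"
    by (simp add: algebra_simps power2_eq_square)
  then have "(V * (fps_const x * fps_X ^ 2 * V + 1)) $ l =
      x ^ l + x * (if l < 2 then 0 else of_nat (l - 2 + 1) * x ^ (l - 2))"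
    by (simp only: fps_add_nth fps_mult_left_const_nth fps_X_power_mult_nth V1 V2)
  also have "\<dots> = degree_fps x $ l"
  proof (cases "l < 2")
    case True
    then have "l = 0 \<or> l = 1" by auto
    then show ?thesis by (auto simp: degree_fps_def)
  next
    case False
    then obtain k where "l = k + 2" by (metis add.commute le_Suc_ex not_less)
    then show ?thesis by (simp add: degree_fps_def algebra_simps)
  qed
  finally show "degree_fps x $ l = (V * (fps_const x * fps_X ^ 2 * V + 1)) $ l" ..
qed

text \<open>Expand the second factor binomially; choosing its non-constant term \<open>j\<close>
  times leaves a coefficient of \<open>V ^ (n + 1 + j)\<close>, a negative binomial series.\<close>

lemma degree_fps_power_nth:
  fixes x :: "'a::field_char_0"
  shows "(degree_fps x ^ (n + 1)) $ n =
    (\<Sum>j=0..n. of_nat ((n + 1) choose j) * of_nat ((2 * n - j) choose (n + j)) * x ^ (n - j))"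
proof -
  define V where "V = inverse (1 - fps_const x * fps_X)"
  let ?t = "\<lambda>j. of_nat ((n + 1) choose j) * of_nat ((2 * n - j) choose (n + j)) * x ^ (n - j)"
  have V: "V ^ k $ i = of_nat ((k + i - 1) choose i) * x ^ i" if "k > 0" for k i
    using one_minus_const_fps_X_neg_power'[OF that, of x] by (simp add: V_def fps_inverse_power)
  have "degree_fps x ^ (n + 1) = V ^ (n + 1) * (fps_const x * fps_X ^ 2 * V + 1) ^ (n + 1)"
    by (simp only: degree_fps_eq V_def power_mult_distrib)
  also have "\<dots> = (\<Sum>j\<le>n + 1. fps_const (of_nat ((n + 1) choose j) * x ^ j) *
      (fps_X ^ (2 * j) * V ^ (n + 1 + j)))"
    unfolding binomial_ring sum_distrib_left
    by (intro sum.cong refl)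
      (simp add: power_mult_distrib power_add fps_of_nat[symmetric] mult_ac
         flip: fps_const_mult power_mult)
  finally have "(degree_fps x ^ (n + 1)) $ n = (\<Sum>j\<le>n + 1. of_nat ((n + 1) choose j) * x ^ j *
      (if n < 2 * j then 0 else V ^ (n + 1 + j) $ (n - 2 * j)))"
    by (simp only: fps_sum_nth fps_mult_left_const_nth fps_X_power_mult_nth)
  also have "\<dots> = (\<Sum>j\<le>n + 1. ?t j)"
  proof (intro sum.cong refl)
    fix j
    show "of_nat ((n + 1) choose j) * x ^ j *
      (if n < 2 * j then 0 else V ^ (n + 1 + j) $ (n - 2 * j)) = ?t j"
    proof (cases "n < 2 * j")
      \<comment> \<open>Here \<open>2 * n - j < n + j\<close>, so the second binomial coefficient
        vanishes as well.\<close>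
      case True
      then show ?thesis by (simp add: binomial_eq_0)
    next
      case False
      then have e: "n + 1 + j + (n - 2 * j) - 1 = 2 * n - j" by simp
      have "(2 * n - j) choose (n - 2 * j) = (2 * n - j) choose (n + j)"
        using False by (subst binomial_symmetric) auto
      moreover have "x ^ (n - j) = x ^ j * x ^ (n - 2 * j)"
        using False by (simp flip: power_add)
      ultimately show ?thesis
        using False V[of "n + 1 + j" "n - 2 * j"] unfolding e by simp
    qed
  qed
  \<comment> \<open>The term at \<open>j = n + 1\<close> vanishes for the same reason.\<close>
  also have "\<dots> = (\<Sum>j=0..n. ?t j)"
    by (simp add: atMost_atLeast0 binomial_eq_0)
  finally show ?thesis .
qed

section \<open>Return to Stirling permutations\<close>

text \<open>With \<open>s = 0\<close> every letter occurs, so the condition on missing letters is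
  vacuous.\<close>

lemma stirling_perms_avoiding_123_eq:
  "stirling_perms_avoiding_123 n = partial_words {1..n} 0"
proof -
  have "\<sigma> \<in> stirling_perms_avoiding_123 n \<longleftrightarrow>
      mset \<sigma> = mset_set {1..n} + mset_set {1..n} \<and> triples_wrt admissible \<sigma>" for \<sigma>
    unfolding stirling_perms_avoiding_123_def stirling_perms_def contains_123_def
      triples_wrt_iff_nth admissible_def by auto
  moreover have "mset \<sigma> = mset_set {1..n} + mset_set {1..n} \<longleftrightarrow>
      set \<sigma> = {1..n} \<and> (\<forall>y\<in>set \<sigma>. count (mset \<sigma>) y = 2)" for \<sigma>
  proof
    assume *: "mset \<sigma> = mset_set {1..n} + mset_set {1..n}"
    from arg_cong[OF *, of set_mset] have "set \<sigma> = {1..n}" by simp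
    with * show "set \<sigma> = {1..n} \<and> (\<forall>y\<in>set \<sigma>. count (mset \<sigma>) y = 2)" by simp
  next
    assume *: "set \<sigma> = {1..n} \<and> (\<forall>y\<in>set \<sigma>. count (mset \<sigma>) y = 2)"
    show "mset \<sigma> = mset_set {1..n} + mset_set {1..n}"
    proof (rule multiset_eqI)
      fix y
      show "count (mset \<sigma>) y = count (mset_set {1..n} + mset_set {1..n}) y"
      proof (cases "y \<in> {1..n}")
        case False
        then have "count (mset \<sigma>) y = 0" using * by simp
        with False show ?thesis by auto
      qed (use * in simp)
    qed
  qed
  moreover have "\<sigma> \<in> partial_words {1..n} 0 \<longleftrightarrow> set \<sigma> = {1..n} \<and>
      (\<forall>y\<in>set \<sigma>. count (mset \<sigma>) y = 2) \<and> triples_wrt admissible \<sigma>" for \<sigma>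
    unfolding partial_words_def by auto
  ultimately show ?thesis by blast
qed

theorem theorem1p2:
  fixes n :: nat and p q r :: "'a::comm_ring_1" and x :: "'b::field_char_0"
  assumes "n \<ge> 1"
  shows "q * C_123 n p q r = p * C_123 n q p r
    \<and> (\<Sum>\<sigma>\<in>stirling_perms_avoiding_123 n. x ^ plat \<sigma>) =
      1 / of_nat (n + 1) *
        (\<Sum>j=0..n. of_nat ((n + 1) choose j) * of_nat ((2 * n - j) choose (n + j)) * x ^ (n - j))"
proof -
  \<comment> \<open>Here \<open>n \<ge> 1\<close> enters: \<open>weight_eq\<close> needs a last
    letter.\<close>
  have ne: "\<sigma> \<noteq> []" if "\<sigma> \<in> stirling_perms_avoiding_123 n" for \<sigma>
    using that assms by (auto simp: stirling_perms_avoiding_123_eq partial_words_def)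
  have "q * C_123 n p q r = gen p q r n 0" for p q r :: 'a
  proof -
    have "q * C_123 n p q r = (\<Sum>\<sigma>\<in>stirling_perms_avoiding_123 n. weight p q r \<sigma>)"
      unfolding C_123_def sum_distrib_left
      by (intro sum.cong refl) (use ne in \<open>simp add: weight_eq\<close>)
    then show ?thesis
      using sum_weight_partial_words[of "{1..n}" p q r 0]
      by (simp add: stirling_perms_avoiding_123_eq)
  qed
  then have "q * C_123 n p q r = p * C_123 n q p r"
    using gen_swap by metis
  moreover have "(\<Sum>\<sigma>\<in>stirling_perms_avoiding_123 n. x ^ plat \<sigma>) = gen x 1 1 n 0"
  proof -
    have "(\<Sum>\<sigma>\<in>stirling_perms_avoiding_123 n. x ^ plat \<sigma>) =
        (\<Sum>\<sigma>\<in>stirling_perms_avoiding_123 n. weight x 1 1 \<sigma>)"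
      by (intro sum.cong refl) (use ne in \<open>simp add: weight_eq\<close>)
    then show ?thesis
      using sum_weight_partial_words[of "{1..n}" x 1 1 0]
      by (simp add: stirling_perms_avoiding_123_eq)
  qed
  moreover have "gen x 1 1 n 0 = 1 / of_nat (n + 1) * (degree_fps x ^ (n + 1)) $ n"
    using gen_1_1[of 0 n x] by simp
  ultimately show ?thesis
    by (simp only: degree_fps_power_nth)
qed

end
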